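(* Consider the central version of the semi-discrete Active Flux method for $\partial_t u+\partial_x u=0$ with periodic boundary conditions on a uniform grid with $n$ cells. It can be written as $\frac{\mathrm d}{\mathrm dt}\mathbf u + D\mathbf u=\mathbf 0$ with the $2n\times 2n$ matrix $D$ given by $$(D\mathbf u)_{i}=\frac{u_{i+1/2}-u_{i-1/2}}{\Delta x},\qquad (D\mathbf u)_{i+1/2}=\frac{u_{i-1/2}-3u_i+3u_{i+1}-u_{i+3/2}}{\Delta x}.$$ Let $M$ be the $2n\times 2n$ diagonal matrix given by $$(M\mathbf u)_i=\tfrac{3\Delta x}{4}\,u_i,\qquad (M\mathbf u)_{i+1/2}=\tfrac{\Delta x}{4}\,u_{i+1/2}.$$ Then $D$ together with $M$ is a periodic diagonal-norm SBP operator on $[x_{\min},x_{\max}]$; in particular $\mathbf 1^TM\mathbf 1=x_{\max}-x_{\min}$.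
   Context: Grid: $[x_{\min},x_{\max}]$ is divided into $n$ cells $[x_{i-1/2},x_{i+1/2}]$, $i=0,\dots,n-1$, of equal length $\Delta x=(x_{\max}-x_{\min})/n$, with centers $x_i$. Degrees of freedom are cell averages $u_i$ and point values $u_{i+1/2}$ at cell interfaces. By periodicity $u_{i+n}=u_i$ and $u_{i+n+1/2}=u_{i+1/2}$, so cell indices are taken modulo $n$. They are collected in $\mathbf u=(u_{-1/2},u_0,u_{1/2},u_1,\dots,u_{n-3/2},u_{n-1})^T\in\mathbb R^{2n}$. For a $2n\times2n$ matrix $A$, $(A\mathbf u)_i$ and $(A\mathbf u)_{i+1/2}$ denote the components of $A\mathbf u$ at the positions of $u_i$ and $u_{i+1/2}$. Reconstruction: in cell $i$, $u_{\mathrm{recon},i}$ is the unique polynomial of degree at most $2$ on $[-\Delta x/2,\Delta x/2]$ with $u_{\mathrm{recon},i}(\pm\Delta x/2)=u_{i\pm1/2}$ and mean value $u_i$. Central semi-discrete Active Flux method (for $\partial_tu+\partial_xu=0$): $\frac{\mathrm d}{\mathrm dt}u_i+\frac{u_{i+1/2}-u_{i-1/2}}{\Delta x}=0$ and $\frac{\mathrm d}{\mathrm dt}u_{i+1/2}+\frac12\left(u_{\mathrm{recon},i}'(\Delta x/2)+u_{\mathrm{recon},i+1}'(-\Delta x/2)\right)=0$ for all $i$. $\mathbf 1$ is the all-ones vector and $\mathbf 0$ the zero vector. A periodic SBP (summation-by-parts) operator on $[x_{\min},x_{\max}]$ consists of a grid, a consistent derivative matrix $D$ (i.e. $D\mathbf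 1=\mathbf 0$), and a symmetric positive definite mass (norm) matrix $M$ with $MD+D^TM=0$, scaled so that $\mathbf 1^TM\mathbf 1=x_{\max}-x_{\min}$. It is diagonal-norm if $M$ is diagonal. *)

theory Defs
  imports
    "HOL-Analysis.Henstock_Kurzweil_Integration"
    "HOL-Computational_Algebra.Polynomial"
    "Jordan_Normal_Form.Matrix"
begin

section \<open>Degrees of freedom\<close>

text \<open>
  The degrees of freedom are stored as
  (u_{-1/2}, u_0, u_{1/2}, u_1, ..., u_{n-3/2}, u_{n-1}), with vector positions counted from 0:
  u_i has position 2i+1 and u_{i-1/2} has position 2i. Cell indices are integers and are
  reduced modulo n. Interfaces are named by the cell on their left: index i of
  point_pos and point_val refers to the interface i+1/2.
\<close>

definition cell_pos :: "nat \<Rightarrow> int \<Rightarrow> nat" where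
  "cell_pos n i = 2 * nat (i mod int n) + 1"

definition point_pos :: "nat \<Rightarrow> int \<Rightarrow> nat" where
  "point_pos n i = 2 * nat ((i + 1) mod int n)"

definition cell_avg :: "nat \<Rightarrow> real vec \<Rightarrow> int \<Rightarrow> real" where
  "cell_avg n u i = u $ cell_pos n i"

definition point_val :: "nat \<Rightarrow> real vec \<Rightarrow> int \<Rightarrow> real" where
  "point_val n u i = u $ point_pos n i"

text \<open>
  The vector with the values a i at the positions of u_i and p i at the positions of
  u_{i+1/2}; even position k holds the interface k/2 - 1/2, whose index is k/2 - 1.
\<close>

definition assemble :: "nat \<Rightarrow> (int \<Rightarrow> real) \<Rightarrow> (int \<Rightarrow> real) \<Rightarrow> real vec" where
  "assemble n a p =
     vec (2 * n) (\<lambda>k. if odd k then a (int (k div 2)) else p (int (k div 2) - 1))"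

definition mat_of_map :: "nat \<Rightarrow> (real vec \<Rightarrow> real vec) \<Rightarrow> real mat" where
  "mat_of_map N f = mat N N (\<lambda>(r, c). f (unit_vec N c) $ r)"

definition ones_vec :: "nat \<Rightarrow> real vec" where
  "ones_vec N = vec N (\<lambda>_. 1)"


section \<open>The central semi-discrete Active Flux method\<close>

definition cell_size :: "real \<Rightarrow> real \<Rightarrow> nat \<Rightarrow> real" where
  "cell_size xmin xmax n = (xmax - xmin) / real n"

definition is_recon :: "real \<Rightarrow> real \<Rightarrow> real \<Rightarrow> real \<Rightarrow> real poly \<Rightarrow> bool" where
  "is_recon dx l m r p \<longleftrightarrow>
     degree p \<le> 2 \<and> poly p (- dx / 2) = l \<and> poly p (dx / 2) = r \<and>
     integral {- dx / 2..dx / 2} (poly p) / dx = m"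

lemma integral_quadratic:
  fixes a b c h :: real
  assumes "h > 0"
  shows "integral {- h / 2..h / 2} (poly [:a, b, c:]) = a * h + c * h ^ 3 / 12"
proof -
  have "(poly [:a, b, c:] has_integral
      (a * (h/2) + b * (h/2)^2 / 2 + c * (h/2)^3 / 3)
      - (a * (-h/2) + b * (-h/2)^2 / 2 + c * (-h/2)^3 / 3)) {- h / 2..h / 2}"
  proof (rule fundamental_theorem_of_calculus)
    show "- h / 2 \<le> h / 2" using assms by simp
    fix x assume "x \<in> {- h / 2..h / 2}"
    show "((\<lambda>x. a * x + b * x^2 / 2 + c * x^3 / 3) has_vector_derivative poly [:a, b, c:] x)
        (at x within {- h / 2..h / 2})"
      unfolding has_real_derivative_iff_has_vector_derivative[symmetric]
      by (auto intro!: derivative_eq_intros simp: algebra_simps power2_eq_square)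
  qed
  then show ?thesis
    by (auto dest!: integral_unique simp: algebra_simps power2_eq_square power3_eq_cube)
qed

lemma is_recon_ex1:
  assumes "dx > 0"
  shows "\<exists>!p. is_recon dx l m r p"
proof -
  let ?a = "(6 * m - l - r) / 4" and ?b = "(r - l) / dx" and ?c = "3 * (l + r - 2 * m) / dx^2"
  have iff: "is_recon dx l m r [:a, b, c:] \<longleftrightarrow> a = ?a \<and> b = ?b \<and> c = ?c" for a b c
  proof -
    let ?B = "b * dx" and ?C = "c * dx^2"
    have deg: "degree [:a, b, c:] \<le> 2" by simp
    have mean: "(a * dx + c * dx^3 / 12) / dx = a + ?C / 12"
      using assms by (simp add: field_simps power2_eq_square power3_eq_cube)
    have "is_recon dx l m r [:a, b, c:] \<longleftrightarrow>
        a - ?B / 2 + ?C / 4 = l \<and> a + ?B / 2 + ?C / 4 = r \<and> a + ?C / 12 = m"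
      unfolding is_recon_def integral_quadratic[OF assms] mean using deg
      by (simp add: algebra_simps power2_eq_square)
    also have "\<dots> \<longleftrightarrow> a = ?a \<and> ?B = r - l \<and> ?C = 3 * (l + r - 2 * m)"
      by (simp add: field_simps) argo
    also have "\<dots> \<longleftrightarrow> a = ?a \<and> b = ?b \<and> c = ?c"
      using assms by (simp add: nonzero_eq_divide_eq)
    finally show ?thesis .
  qed
  have quad: "p = [:coeff p 0, coeff p 1, coeff p 2:]" if "degree p \<le> 2" for p :: "real poly"
    using that by (auto simp: poly_eq_iff coeff_pCons coeff_eq_0 numeral_2_eq_2 split: nat.splits)
  show ?thesis
  proof (rule ex1I)
    show "is_recon dx l m r [:?a, ?b, ?c:]" by (simp only: iff simp_thms)
    fix p assume p: "is_recon dx l m r p"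
    then have "p = [:coeff p 0, coeff p 1, coeff p 2:]" by (intro quad) (simp add: is_recon_def)
    with p iff show "p = [:?a, ?b, ?c:]" by metis
  qed
qed

definition recon :: "real \<Rightarrow> nat \<Rightarrow> real vec \<Rightarrow> int \<Rightarrow> real poly" where
  "recon dx n u i =
     (THE p. is_recon dx (point_val n u (i - 1)) (cell_avg n u i) (point_val n u i) p)"

definition has_vec_deriv ::
    "nat \<Rightarrow> (real \<Rightarrow> real vec) \<Rightarrow> real vec \<Rightarrow> real \<Rightarrow> real set \<Rightarrow> bool" where
  "has_vec_deriv N u u' t T \<longleftrightarrow>
     u' \<in> carrier_vec N \<and>
     (\<forall>k<N. ((\<lambda>s. u s $ k) has_real_derivative u' $ k) (at t within T))"

definition central_active_flux :: "real \<Rightarrow> nat \<Rightarrow> real set \<Rightarrow> (real \<Rightarrow> real vec) \<Rightarrow> bool" where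
  "central_active_flux dx n T u \<longleftrightarrow>
     (\<forall>t\<in>T. \<exists>u'. has_vec_deriv (2 * n) u u' t T \<and>
        (\<forall>i. cell_avg n u' i + (point_val n (u t) i - point_val n (u t) (i - 1)) / dx = 0) \<and>
        (\<forall>i. point_val n u' i +
              1 / 2 * (poly (pderiv (recon dx n (u t) i)) (dx / 2) +
                       poly (pderiv (recon dx n (u t) (i + 1))) (- dx / 2)) = 0))"

definition linear_ode :: "nat \<Rightarrow> real mat \<Rightarrow> real set \<Rightarrow> (real \<Rightarrow> real vec) \<Rightarrow> bool" where
  "linear_ode N D T u \<longleftrightarrow>
     (\<forall>t\<in>T. \<exists>u'. has_vec_deriv N u u' t T \<and> u' + D *\<^sub>v u t = 0\<^sub>v N)"

definition AF_D :: "real \<Rightarrow> nat \<Rightarrow> real mat" where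
  "AF_D dx n = mat_of_map (2 * n) (\<lambda>u. assemble n
     (\<lambda>i. (point_val n u i - point_val n u (i - 1)) / dx)
     (\<lambda>i. (point_val n u (i - 1) - 3 * cell_avg n u i + 3 * cell_avg n u (i + 1)
            - point_val n u (i + 1)) / dx))"

definition AF_M :: "real \<Rightarrow> nat \<Rightarrow> real mat" where
  "AF_M dx n = mat_of_map (2 * n) (\<lambda>u. assemble n
     (\<lambda>i. 3 * dx / 4 * cell_avg n u i)
     (\<lambda>i. dx / 4 * point_val n u i))"

text \<open>
  The location of each degree of freedom: the interface x_{i-1/2} (position 2i) for a point
  value and the cell center x_i (position 2i+1) for an average.
\<close>

definition AF_grid :: "real \<Rightarrow> real \<Rightarrow> nat \<Rightarrow> real vec" where
  "AF_grid xmin xmax n = vec (2 * n) (\<lambda>k. xmin + real k * (cell_size xmin xmax n / 2))"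


section \<open>Periodic SBP operators\<close>

definition symmetric_positive_definite :: "real mat \<Rightarrow> bool" where
  "symmetric_positive_definite M \<longleftrightarrow>
     square_mat M \<and> transpose_mat M = M \<and>
     (\<forall>v\<in>carrier_vec (dim_row M). v \<noteq> 0\<^sub>v (dim_row M) \<longrightarrow> scalar_prod v (M *\<^sub>v v) > 0)"

text \<open>
  The grid x lists the nodes of the degrees of freedom from left to right. Repeated nodes
  are allowed, as they occur in multi-block operators.
\<close>

definition periodic_SBP ::
    "real \<Rightarrow> real \<Rightarrow> nat \<Rightarrow> real vec \<Rightarrow> real mat \<Rightarrow> real mat \<Rightarrow> bool" where
  "periodic_SBP xmin xmax N x D M \<longleftrightarrow>
     x \<in> carrier_vec N \<and> (\<forall>k<N. x $ k \<in> {xmin..xmax}) \<and>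
     (\<forall>j k. j \<le> k \<longrightarrow> k < N \<longrightarrow> x $ j \<le> x $ k) \<and>
     D \<in> carrier_mat N N \<and> D *\<^sub>v ones_vec N = 0\<^sub>v N \<and>
     M \<in> carrier_mat N N \<and> symmetric_positive_definite M \<and>
     M * D + transpose_mat D * M = 0\<^sub>m N N \<and>
     scalar_prod (ones_vec N) (M *\<^sub>v ones_vec N) = xmax - xmin"

definition periodic_diagonal_norm_SBP ::
    "real \<Rightarrow> real \<Rightarrow> nat \<Rightarrow> real vec \<Rightarrow> real mat \<Rightarrow> real mat \<Rightarrow> bool" where
  "periodic_diagonal_norm_SBP xmin xmax N x D M \<longleftrightarrow>
     periodic_SBP xmin xmax N x D M \<and> diagonal_mat M"

end

theory Submission
  imports Defs
begin

text \<open>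
  The reconstruction in a cell with boundary values \<open>l\<close>, \<open>r\<close> and mean \<open>m\<close> is an explicit parabola;
  its slopes at the right and left end are \<open>(2l - 6m + 4r)/dx\<close> and \<open>(6m - 4l - 2r)/dx\<close>. Averaging the slope at
  the right end of cell \<open>i\<close> and the one at the left end of cell \<open>i + 1\<close>, the contributions of the
  shared interface value cancel, which gives the point-value rows of \<open>D\<close>
  (\<open>average_of_recon_slopes\<close>).

  For the SBP property, write \<open>a\<close>, \<open>p\<close> for the averages and point values of \<open>u\<close>, and \<open>b\<close>, \<open>q\<close>
  for those of \<open>v\<close>. Multiplying by \<open>M\<close> clears all the denominators in \<open>D\<close>, and
  \<open>4 v\<^sup>T (M D + D\<^sup>T M) u\<close> becomes the sum over the cells of
  \<open>3 b\<^sub>i (p\<^sub>i - p\<^sub>i\<^sub>-\<^sub>1) + q\<^sub>i (p\<^sub>i\<^sub>-\<^sub>1 - 3 a\<^sub>i + 3 a\<^sub>i\<^sub>+\<^sub>1 - p\<^sub>i\<^sub>+\<^sub>1)\<close> plus the same expression with \<open>u\<close> and \<open>v\<close>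
  exchanged. This summand is a difference \<open>g\<^sub>i\<^sub>+\<^sub>1 - g\<^sub>i\<close> of a periodic grid function, so the sum over one period
  telescopes to zero (\<open>AF_energy_product_skew\<close>). It is the ratio \<open>3 : 1\<close> of the weights that makes
  the products of averages with point values combine to a difference; normalizing the weights to
  \<open>3/4\<close> and \<open>1/4\<close> gives each cell the total mass \<open>dx\<close>.

  The operators are given as matrices of maps between vectors of degrees of freedom. Since these
  maps are linear, the matrices act as the maps (\<open>mat_of_map_mult_vec\<close>), and all the computations
  can be done cell by cell.
\<close>

section \<open>Matrices of linear maps\<close>

text \<open>
  Adding the coordinates of \<open>u\<close> one at a time expresses \<open>f u\<close> by the images of the unit vectors,
  which are the columns of the matrix.
\<close>
lemma mat_of_map_mult_vec:
  assumes add: "\<And>u v. u \<in> carrier_vec N \<Longrightarrow> v \<in> carrier_vec N \<Longrightarrow> f (u + v) = f u + f v"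
    and smult: "\<And>c u. u \<in> carrier_vec N \<Longrightarrow> f (c \<cdot>\<^sub>v u) = c \<cdot>\<^sub>v f u"
    and carrier: "\<And>u. u \<in> carrier_vec N \<Longrightarrow> f u \<in> carrier_vec N"
    and u: "u \<in> carrier_vec N"
  shows "mat_of_map N f *\<^sub>v u = f u"
proof (rule eq_vecI)
  show "dim_vec (mat_of_map N f *\<^sub>v u) = dim_vec (f u)"
    using carrier[OF u] by (simp add: mat_of_map_def)
  fix r assume "r < dim_vec (f u)"
  then have r: "r < N" using carrier[OF u] by simp
  define trunc where "trunc k = vec N (\<lambda>c. if c < k then u $ c else 0)" for k
  have trunc_carrier: "trunc k \<in> carrier_vec N" for k by (simp add: trunc_def)
  have "f (trunc k) $ r = (\<Sum>c<k. f (unit_vec N c) $ r * u $ c)" if "k \<le> N" for k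
    using that
  proof (induction k)
    case 0
    have "trunc 0 = 0 \<cdot>\<^sub>v trunc 0" by (rule eq_vecI) (simp_all add: trunc_def)
    then have "f (trunc 0) = 0 \<cdot>\<^sub>v f (trunc 0)" using smult[OF trunc_carrier] by metis
    moreover have "(0 \<cdot>\<^sub>v f (trunc 0)) $ r = 0" using carrier[OF trunc_carrier, of 0] r by simp
    ultimately show ?case by simp
  next
    case (Suc k)
    have "trunc (Suc k) = trunc k + u $ k \<cdot>\<^sub>v unit_vec N k"
      by (rule eq_vecI) (auto simp: trunc_def unit_vec_def less_Suc_eq)
    then have "f (trunc (Suc k)) = f (trunc k) + u $ k \<cdot>\<^sub>v f (unit_vec N k)"
      by (simp add: add smult trunc_carrier)
    then show ?case
      using Suc r carrier[OF trunc_carrier, of k] carrier[of "unit_vec N k"] by simp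
  qed
  moreover have "trunc N = u" using u by (intro eq_vecI) (auto simp: trunc_def)
  ultimately have "f u $ r = (\<Sum>c<N. f (unit_vec N c) $ r * u $ c)" by force
  then show "(mat_of_map N f *\<^sub>v u) $ r = f u $ r"
    using r u by (simp add: mat_of_map_def scalar_prod_def atLeast0LessThan)
qed

lemma zero_mat_if_bilinear_form_zero:
  fixes A :: "real mat"
  assumes A: "A \<in> carrier_mat m n"
    and zero: "\<And>u v. u \<in> carrier_vec n \<Longrightarrow> v \<in> carrier_vec m \<Longrightarrow> v \<bullet> (A *\<^sub>v u) = 0"
  shows "A = 0\<^sub>m m n"
proof (rule eq_matI)
  fix i j assume "i < dim_row (0\<^sub>m m n :: real mat)" "j < dim_col (0\<^sub>m m n :: real mat)"
  then have ij: "i < m" "j < n" by auto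
  have "unit_vec m i \<bullet> (A *\<^sub>v unit_vec n j) = A $$ (i, j)"
    using ij A by (simp add: scalar_prod_right_unit)
  then show "A $$ (i, j) = 0\<^sub>m m n $$ (i, j)" using zero ij by simp
qed (use A in auto)


section \<open>Degrees of freedom and periodic sums\<close>

lemma cell_pos_less: "n > 0 \<Longrightarrow> cell_pos n i < 2 * n"
  unfolding cell_pos_def
  using pos_mod_bound[of "int n" i] pos_mod_sign[of "int n" i] by linarith

lemma point_pos_less: "n > 0 \<Longrightarrow> point_pos n i < 2 * n"
  unfolding point_pos_def
  using pos_mod_bound[of "int n" "i + 1"] pos_mod_sign[of "int n" "i + 1"] by linarith

lemma cell_avg_cong: "i mod int n = j mod int n \<Longrightarrow> cell_avg n u i = cell_avg n u j"
  by (simp add: cell_avg_def cell_pos_def)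

lemma point_val_cong: "i mod int n = j mod int n \<Longrightarrow> point_val n u i = point_val n u j"
  unfolding point_val_def point_pos_def by (metis mod_add_left_eq)

lemma cell_avg_nat: "i < n \<Longrightarrow> cell_avg n u (int i) = u $ (2 * i + 1)"
  by (simp add: cell_avg_def cell_pos_def)

lemma point_val_nat: "i < n \<Longrightarrow> point_val n u (int i - 1) = u $ (2 * i)"
  by (simp add: point_val_def point_pos_def)

lemma eq_vec_dofsI:
  assumes "u \<in> carrier_vec (2 * n)" "v \<in> carrier_vec (2 * n)"
    and cell: "\<And>i. cell_avg n u i = cell_avg n v i"
    and point: "\<And>i. point_val n u i = point_val n v i"
  shows "u = v"
proof (rule eq_vecI)
  fix k assume "k < dim_vec v"
  then have k: "k < 2 * n" using assms by simp
  show "u $ k = v $ k"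
  proof (cases "even k")
    case True
    then obtain i where "k = 2 * i" by (elim evenE)
    then show ?thesis using k point[of "int i - 1"] by (simp add: point_val_nat)
  next
    case False
    then obtain i where "k = 2 * i + 1" by (elim oddE)
    then show ?thesis using k cell[of "int i"] by (simp add: cell_avg_nat)
  qed
qed (use assms in simp)

lemma dof_zero_vec:
  assumes "n > 0"
  shows "cell_avg n (0\<^sub>v (2 * n)) i = 0" and "point_val n (0\<^sub>v (2 * n)) i = 0"
  using assms by (simp_all add: cell_avg_def point_val_def cell_pos_less point_pos_less)

lemma ones_vec_carrier [simp]: "ones_vec N \<in> carrier_vec N"
  by (simp add: ones_vec_def)

lemma dof_ones_vec:
  assumes "n > 0"
  shows "cell_avg n (ones_vec (2 * n)) i = 1" and "point_val n (ones_vec (2 * n)) i = 1"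
  using assms by (simp_all add: cell_avg_def point_val_def ones_vec_def cell_pos_less point_pos_less)

lemma assemble_carrier [simp]: "assemble n a p \<in> carrier_vec (2 * n)"
  by (simp add: assemble_def)

lemma cell_avg_assemble:
  assumes "n > 0" and "a (i mod int n) = a i"
  shows "cell_avg n (assemble n a p) i = a i"
  using assms cell_pos_less[OF assms(1), of i]
  by (simp add: cell_avg_def assemble_def cell_pos_def)

text \<open>
  The stored point values are those of the interfaces \<open>-1, \<dots>, n - 2\<close>; the representative of
  \<open>i\<close> modulo \<open>n\<close> in this range is \<open>(i + 1) mod n - 1\<close>.
\<close>
lemma point_val_assemble:
  assumes "n > 0" and "p ((i + 1) mod int n - 1) = p i"
  shows "point_val n (assemble n a p) i = p i"
  using assms point_pos_less[OF assms(1), of i]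
  by (simp add: point_val_def assemble_def point_pos_def)

lemma sum_shift_periodic:
  fixes f :: "int \<Rightarrow> real"
  assumes "f (int n) = f 0"
  shows "(\<Sum>i<n. f (int i + 1)) = (\<Sum>i<n. f (int i))"
proof -
  have "(\<Sum>i<n. f (int i + 1) - f (int i)) = f (int n) - f 0"
    using sum_lessThan_telescope[of "\<lambda>i. f (int i)" n] by (simp add: add.commute)
  then show ?thesis using assms by (simp add: sum_subtractf)
qed

text \<open>
  Cell \<open>i\<close> is paired with its right interface, whereas positions \<open>2 * i\<close> and \<open>2 * i + 1\<close> hold the
  left interface and the cell: the point values are moved by one index, which periodicity allows.
\<close>
lemma scalar_prod_dofs:
  assumes "v \<in> carrier_vec (2 * n)"
  shows "u \<bullet> v =
    (\<Sum>i<n. cell_avg n u (int i) * cell_avg n v (int i)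
         + point_val n u (int i) * point_val n v (int i))"
proof -
  have split: "(\<Sum>k<2 * n. g k) = (\<Sum>i<n. g (2 * i) + g (2 * i + 1))" for g :: "nat \<Rightarrow> real"
    by (induction n) (simp_all add: add.assoc)
  let ?P = "\<lambda>i. point_val n u (i - 1) * point_val n v (i - 1)"
  have "u \<bullet> v = (\<Sum>i<n. ?P (int i) + cell_avg n u (int i) * cell_avg n v (int i))"
    using assms by (simp add: scalar_prod_def atLeast0LessThan split cell_avg_nat point_val_nat)
  moreover have "?P (int n) = ?P 0"
    by (simp add: point_val_cong[of "int n - 1" n "- 1"])
  then have "(\<Sum>i<n. ?P (int i)) = (\<Sum>i<n. ?P (int i + 1))"
    by (rule sum_shift_periodic[symmetric])
  ultimately show ?thesis by (simp add: sum.distrib)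
qed


section \<open>Action of the derivative and mass matrices\<close>

lemma cell_avg_add:
  "n > 0 \<Longrightarrow> v \<in> carrier_vec (2 * n) \<Longrightarrow> cell_avg n (u + v) i = cell_avg n u i + cell_avg n v i"
  by (simp add: cell_avg_def cell_pos_less)

lemma point_val_add:
  "n > 0 \<Longrightarrow> v \<in> carrier_vec (2 * n) \<Longrightarrow> point_val n (u + v) i = point_val n u i + point_val n v i"
  by (simp add: point_val_def point_pos_less)

lemma cell_avg_smult:
  "n > 0 \<Longrightarrow> u \<in> carrier_vec (2 * n) \<Longrightarrow> cell_avg n (c \<cdot>\<^sub>v u) i = c * cell_avg n u i"
  by (simp add: cell_avg_def cell_pos_less)

lemma point_val_smult:
  "n > 0 \<Longrightarrow> u \<in> carrier_vec (2 * n) \<Longrightarrow> point_val n (c \<cdot>\<^sub>v u) i = c * point_val n u i"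
  by (simp add: point_val_def point_pos_less)

lemmas dof_linear = cell_avg_add point_val_add cell_avg_smult point_val_smult

lemma assemble_add: "assemble n (\<lambda>i. a i + b i) (\<lambda>i. p i + q i) = assemble n a p + assemble n b q"
  by (rule eq_vecI) (simp_all add: assemble_def)

lemma assemble_smult: "assemble n (\<lambda>i. c * a i) (\<lambda>i. c * p i) = c \<cdot>\<^sub>v assemble n a p"
  by (rule eq_vecI) (simp_all add: assemble_def)

lemma AF_D_carrier [simp]: "AF_D dx n \<in> carrier_mat (2 * n) (2 * n)"
  by (simp add: AF_D_def mat_of_map_def)

lemma AF_M_carrier [simp]: "AF_M dx n \<in> carrier_mat (2 * n) (2 * n)"
  by (simp add: AF_M_def mat_of_map_def)

lemma AF_D_mult_vec:
  assumes n: "n > 0" and "u \<in> carrier_vec (2 * n)"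
  shows "AF_D dx n *\<^sub>v u = assemble n
     (\<lambda>i. (point_val n u i - point_val n u (i - 1)) / dx)
     (\<lambda>i. (point_val n u (i - 1) - 3 * cell_avg n u i + 3 * cell_avg n u (i + 1)
            - point_val n u (i + 1)) / dx)"
  unfolding AF_D_def using assms(2)
  by (rule mat_of_map_mult_vec[rotated -1])
    (simp_all add: dof_linear n flip: assemble_add assemble_smult,
     simp_all add: algebra_simps add_divide_distrib diff_divide_distrib)

lemma AF_M_mult_vec:
  assumes n: "n > 0" and "u \<in> carrier_vec (2 * n)"
  shows "AF_M dx n *\<^sub>v u = assemble n
     (\<lambda>i. 3 * dx / 4 * cell_avg n u i) (\<lambda>i. dx / 4 * point_val n u i)"
  unfolding AF_M_def using assms(2)
  by (rule mat_of_map_mult_vec[rotated -1])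
    (simp_all add: dof_linear n flip: assemble_add assemble_smult,
     simp_all add: algebra_simps add_divide_distrib)

lemma cell_avg_AF_D:
  assumes "n > 0" "u \<in> carrier_vec (2 * n)"
  shows "cell_avg n (AF_D dx n *\<^sub>v u) i = (point_val n u i - point_val n u (i - 1)) / dx"
proof -
  have "point_val n u (i mod int n) = point_val n u i"
    "point_val n u (i mod int n - 1) = point_val n u (i - 1)"
    by (intro point_val_cong; simp add: mod_simps)+
  then show ?thesis unfolding AF_D_mult_vec[OF assms]
    by (subst cell_avg_assemble) (simp_all add: assms(1))
qed

lemma point_val_AF_D:
  assumes "n > 0" "u \<in> carrier_vec (2 * n)"
  shows "point_val n (AF_D dx n *\<^sub>v u) i =
    (point_val n u (i - 1) - 3 * cell_avg n u i + 3 * cell_avg n u (i + 1)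
      - point_val n u (i + 1)) / dx"
proof -
  let ?j = "(i + 1) mod int n - 1"
  have j: "(?j + k) mod int n = (i + k) mod int n" for k
    using mod_add_left_eq[of "i + 1" "int n" "k - 1"] by (simp add: algebra_simps)
  have "point_val n u (?j - 1) = point_val n u (i - 1)" "cell_avg n u ?j = cell_avg n u i"
    "cell_avg n u (?j + 1) = cell_avg n u (i + 1)" "point_val n u (?j + 1) = point_val n u (i + 1)"
    using j[of "- 1"] j[of 0] j[of 1] by (auto intro!: point_val_cong cell_avg_cong)
  then show ?thesis unfolding AF_D_mult_vec[OF assms]
    by (subst point_val_assemble) (simp_all add: assms(1))
qed

lemma cell_avg_AF_M:
  assumes "n > 0" "u \<in> carrier_vec (2 * n)"
  shows "cell_avg n (AF_M dx n *\<^sub>v u) i = 3 * dx / 4 * cell_avg n u i"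
  unfolding AF_M_mult_vec[OF assms]
  by (subst cell_avg_assemble) (simp_all add: assms(1) cell_avg_cong[of "i mod int n" n i])

lemma point_val_AF_M:
  assumes "n > 0" "u \<in> carrier_vec (2 * n)"
  shows "point_val n (AF_M dx n *\<^sub>v u) i = dx / 4 * point_val n u i"
proof -
  have "point_val n u ((i + 1) mod int n - 1) = point_val n u i"
    by (intro point_val_cong) (simp add: mod_simps)
  then show ?thesis unfolding AF_M_mult_vec[OF assms]
    by (subst point_val_assemble) (simp_all add: assms(1))
qed

lemmas AF_dofs = cell_avg_AF_D point_val_AF_D cell_avg_AF_M point_val_AF_M


section \<open>The method as a linear system\<close>

lemma recon_eq:
  fixes n :: nat and u :: "real vec" and i :: int and dx :: real
  assumes dx: "dx > 0"
  defines "l \<equiv> point_val n u (i - 1)" and "m \<equiv> cell_avg n u i" and "r \<equiv> point_val n u i"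
  shows "recon dx n u i = [:(6 * m - l - r) / 4, (r - l) / dx, 3 * (l + r - 2 * m) / dx^2:]"
proof -
  let ?q = "[:(6 * m - l - r) / 4, (r - l) / dx, 3 * (l + r - 2 * m) / dx^2:]"
  have "is_recon dx l m r ?q"
    unfolding is_recon_def integral_quadratic[OF dx]
    using dx by (simp add: field_simps power2_eq_square power3_eq_cube)
  then show ?thesis
    unfolding recon_def l_def m_def r_def by (rule the1_equality[OF is_recon_ex1[OF dx]])
qed

text \<open>The interface value \<open>u\<^sub>i\<^sub>+\<^sub>1\<^sub>/\<^sub>2\<close> enters the two slopes with opposite coefficients.\<close>
lemma average_of_recon_slopes:
  assumes "dx > 0"
  shows "1 / 2 * (poly (pderiv (recon dx n u i)) (dx / 2)
      + poly (pderiv (recon dx n u (i + 1))) (- dx / 2)) =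
    (point_val n u (i - 1) - 3 * cell_avg n u i + 3 * cell_avg n u (i + 1)
      - point_val n u (i + 1)) / dx"
  using assms
  by (simp add: recon_eq pderiv_pCons field_simps power2_eq_square)

lemma central_active_flux_iff_linear_ode:
  assumes n: "n > 0" and dx: "dx > 0" and u: "\<forall>t\<in>T. u t \<in> carrier_vec (2 * n)"
  shows "central_active_flux dx n T u \<longleftrightarrow> linear_ode (2 * n) (AF_D dx n) T u"
  unfolding central_active_flux_def linear_ode_def
proof (intro ball_cong[OF refl] ex_cong1 conj_cong[OF refl])
  fix t u'
  assume t: "t \<in> T" and "has_vec_deriv (2 * n) u u' t T"
  then have u': "u' \<in> carrier_vec (2 * n)" by (simp add: has_vec_deriv_def)
  show "(\<forall>i. cell_avg n u' i + (point_val n (u t) i - point_val n (u t) (i - 1)) / dx = 0) \<and>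
      (\<forall>i. point_val n u' i + 1 / 2 * (poly (pderiv (recon dx n (u t) i)) (dx / 2) +
         poly (pderiv (recon dx n (u t) (i + 1))) (- dx / 2)) = 0) \<longleftrightarrow>
      u' + AF_D dx n *\<^sub>v u t = 0\<^sub>v (2 * n)" (is "?L \<longleftrightarrow> ?R")
  proof -
    have ut: "u t \<in> carrier_vec (2 * n)" using u t by blast
    then have Du: "AF_D dx n *\<^sub>v u t \<in> carrier_vec (2 * n)"
      using mult_mat_vec_carrier[OF AF_D_carrier] by blast
    have "?L \<longleftrightarrow> (\<forall>i. cell_avg n (u' + AF_D dx n *\<^sub>v u t) i = 0) \<and>
        (\<forall>i. point_val n (u' + AF_D dx n *\<^sub>v u t) i = 0)"
      unfolding average_of_recon_slopes[OF dx] cell_avg_add[OF n Du] point_val_add[OF n Du]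
        cell_avg_AF_D[OF n ut] point_val_AF_D[OF n ut] ..
    also have "\<dots> \<longleftrightarrow> ?R"
    proof
      assume "(\<forall>i. cell_avg n (u' + AF_D dx n *\<^sub>v u t) i = 0) \<and>
        (\<forall>i. point_val n (u' + AF_D dx n *\<^sub>v u t) i = 0)"
      then show ?R using u' Du n by (intro eq_vec_dofsI[of _ n]) (auto simp: dof_zero_vec)
    qed (simp add: dof_zero_vec n)
    finally show ?thesis .
  qed
qed


section \<open>The SBP properties\<close>

lemma AF_D_ones:
  assumes n: "n > 0"
  shows "AF_D dx n *\<^sub>v ones_vec (2 * n) = 0\<^sub>v (2 * n)"
proof (rule eq_vec_dofsI)
  show "AF_D dx n *\<^sub>v ones_vec (2 * n) \<in> carrier_vec (2 * n)"
    using mult_mat_vec_carrier[OF AF_D_carrier ones_vec_carrier] .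
qed (simp_all add: AF_dofs n dof_ones_vec dof_zero_vec)

lemma ones_AF_M_ones:
  assumes n: "n > 0"
  shows "ones_vec (2 * n) \<bullet> (AF_M dx n *\<^sub>v ones_vec (2 * n)) = real n * dx"
  unfolding scalar_prod_dofs[OF mult_mat_vec_carrier[OF AF_M_carrier ones_vec_carrier]]
    AF_dofs[OF n ones_vec_carrier] dof_ones_vec[OF n]
  by simp

lemma AF_M_entries:
  "AF_M dx n = mat (2 * n) (2 * n)
     (\<lambda>(r, c). if r = c then (if odd r then 3 * dx / 4 else dx / 4) else 0)"
proof (rule eq_matI)
  fix r c
  let ?R = "mat (2 * n) (2 * n)
     (\<lambda>(r, c). if r = c then (if odd r then 3 * dx / 4 else dx / 4) else (0::real))"
  assume "r < dim_row ?R" "c < dim_col ?R"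
  then have rc: "r < 2 * n" "c < 2 * n" by auto
  then have "r div 2 < n" by simp
  note pos = cell_avg_nat[OF this] point_val_nat[OF this]
  show "AF_M dx n $$ (r, c) = ?R $$ (r, c)"
    using rc pos by (cases "odd r")
      (auto simp: AF_M_def mat_of_map_def assemble_def unit_vec_def)
qed (simp_all add: AF_M_def mat_of_map_def)

lemma AF_M_diagonal: "diagonal_mat (AF_M dx n)"
  by (simp add: diagonal_mat_def AF_M_entries)

lemma AF_M_symmetric: "transpose_mat (AF_M dx n) = AF_M dx n"
  by (rule eq_matI) (auto simp: AF_M_entries)

lemma AF_M_positive_definite:
  assumes n: "n > 0" and dx: "dx > 0"
  shows "symmetric_positive_definite (AF_M dx n)"
proof -
  have "v \<bullet> (AF_M dx n *\<^sub>v v) > 0"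
    if v: "v \<in> carrier_vec (2 * n)" and nz: "v \<noteq> 0\<^sub>v (2 * n)" for v
  proof -
    have "v \<bullet> (AF_M dx n *\<^sub>v v) = (\<Sum>i<n. 3 * dx / 4 * (cell_avg n v (int i))\<^sup>2
        + dx / 4 * (point_val n v (int i))\<^sup>2)" (is "_ = ?S")
      by (subst scalar_prod_dofs[OF mult_mat_vec_carrier[OF AF_M_carrier v]])
        (simp add: AF_dofs[OF n v] power2_eq_square algebra_simps)
    moreover have "?S \<ge> 0" using dx by (intro sum_nonneg) simp
    moreover have "?S \<noteq> 0"
    proof
      assume "?S = 0"
      then have "\<forall>i<n. 3 * dx / 4 * (cell_avg n v (int i))\<^sup>2 + dx / 4 * (point_val n v (int i))\<^sup>2 = 0"
        using dx by (subst (asm) sum_nonneg_eq_0_iff) auto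
      then have zero: "cell_avg n v (int i) = 0" "point_val n v (int i) = 0" if "i < n" for i
        using that dx by (auto simp: add_nonneg_eq_0_iff)
      have "nat (i mod int n) < n" for i using n by (simp add: nat_less_iff)
      note zero = zero[OF this]
      have "cell_avg n v i = 0" "point_val n v i = 0" for i
        using zero[of i] n cell_avg_cong[of "i mod int n" n i v] point_val_cong[of "i mod int n" n i v]
        by simp_all
      then have "v = 0\<^sub>v (2 * n)"
        using n v by (intro eq_vec_dofsI[of _ n]) (simp_all add: dof_zero_vec)
      then show False using nz by contradiction
    qed
    ultimately show ?thesis by simp
  qed
  then show ?thesis
    using AF_M_symmetric[of dx n] carrier_matD[OF AF_M_carrier[of dx n]]
    by (simp add: symmetric_positive_definite_def)
qed

text \<open>
  Discrete integration by parts: cell by cell, the sum of the two products is a difference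
  \<open>g (i + 1) - g i\<close>. The flux \<open>g i\<close> at the left end of cell \<open>i\<close> pairs the average of that cell
  with the value at its left interface, and the values at its two interfaces with each other.
\<close>
lemma AF_energy_product_skew:
  assumes n: "n > 0" and dx: "dx \<noteq> 0"
    and u: "u \<in> carrier_vec (2 * n)" and v: "v \<in> carrier_vec (2 * n)"
  shows "v \<bullet> (AF_M dx n *\<^sub>v (AF_D dx n *\<^sub>v u)) + (AF_D dx n *\<^sub>v v) \<bullet> (AF_M dx n *\<^sub>v u) = 0"
proof -
  let ?a = "cell_avg n u" and ?p = "point_val n u"
  let ?b = "cell_avg n v" and ?q = "point_val n v"
  define g where "g i = (3 * (?b i * ?p (i - 1) + ?a i * ?q (i - 1))
      - ?q (i - 1) * ?p i - ?p (i - 1) * ?q i) / 4" for i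
  have Du: "AF_D dx n *\<^sub>v u \<in> carrier_vec (2 * n)"
    using mult_mat_vec_carrier[OF AF_D_carrier u] .
  have "v \<bullet> (AF_M dx n *\<^sub>v (AF_D dx n *\<^sub>v u)) + (AF_D dx n *\<^sub>v v) \<bullet> (AF_M dx n *\<^sub>v u)
      = (\<Sum>i<n. g (int i + 1) - g (int i))"
    unfolding scalar_prod_dofs[OF mult_mat_vec_carrier[OF AF_M_carrier Du]]
      scalar_prod_dofs[OF mult_mat_vec_carrier[OF AF_M_carrier u]]
      AF_dofs[OF n u] AF_dofs[OF n v] AF_dofs[OF n Du] sum.distrib[symmetric] g_def
    using dx by (intro sum.cong) (simp_all add: field_simps)
  moreover have "g (int n) = g 0"
  proof -
    have "?a (int n) = ?a 0" "?b (int n) = ?b 0" by (intro cell_avg_cong; simp)+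
    moreover have "?p (int n) = ?p 0" "?q (int n) = ?q 0"
      "?p (int n - 1) = ?p (0 - 1)" "?q (int n - 1) = ?q (0 - 1)" by (intro point_val_cong; simp)+
    ultimately show ?thesis unfolding g_def by simp
  qed
  then have "(\<Sum>i<n. g (int i + 1)) = (\<Sum>i<n. g (int i))" by (rule sum_shift_periodic)
  ultimately show ?thesis by (simp add: sum_subtractf)
qed

lemma AF_skew:
  assumes "n > 0" and "dx \<noteq> 0"
  shows "AF_M dx n * AF_D dx n + transpose_mat (AF_D dx n) * AF_M dx n = 0\<^sub>m (2 * n) (2 * n)"
    (is "?M * ?D + ?D\<^sup>T * ?M = _")
proof (rule zero_mat_if_bilinear_form_zero)
  have MD: "?M * ?D \<in> carrier_mat (2 * n) (2 * n)"
    by (rule mult_carrier_mat[OF AF_M_carrier AF_D_carrier])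
  have DT: "?D\<^sup>T \<in> carrier_mat (2 * n) (2 * n)" by simp
  have DM: "?D\<^sup>T * ?M \<in> carrier_mat (2 * n) (2 * n)"
    by (rule mult_carrier_mat[OF DT AF_M_carrier])
  then show "?M * ?D + ?D\<^sup>T * ?M \<in> carrier_mat (2 * n) (2 * n)" by simp
  fix u v :: "real vec" assume u: "u \<in> carrier_vec (2 * n)" and v: "v \<in> carrier_vec (2 * n)"
  have Mu: "?M *\<^sub>v u \<in> carrier_vec (2 * n)"
    using mult_mat_vec_carrier[OF AF_M_carrier u] .
  have "v \<bullet> ((?M * ?D + ?D\<^sup>T * ?M) *\<^sub>v u) = v \<bullet> ((?M * ?D) *\<^sub>v u) + v \<bullet> ((?D\<^sup>T * ?M) *\<^sub>v u)"
    unfolding add_mult_distrib_mat_vec[OF MD DM u]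
    by (rule scalar_prod_add_distrib[OF v mult_mat_vec_carrier[OF MD u] mult_mat_vec_carrier[OF DM u]])
  also have "(?M * ?D) *\<^sub>v u = ?M *\<^sub>v (?D *\<^sub>v u)"
    by (rule assoc_mult_mat_vec[OF AF_M_carrier AF_D_carrier u])
  also have "(?D\<^sup>T * ?M) *\<^sub>v u = ?D\<^sup>T *\<^sub>v (?M *\<^sub>v u)"
    by (rule assoc_mult_mat_vec[OF DT AF_M_carrier u])
  also have "v \<bullet> (?D\<^sup>T *\<^sub>v (?M *\<^sub>v u)) = (?D *\<^sub>v v) \<bullet> (?M *\<^sub>v u)"
    using transpose_vec_mult_scalar[OF AF_D_carrier v Mu]
      mult_mat_vec_carrier[OF AF_D_carrier v] Mu v
      mult_mat_vec_carrier[OF DT Mu]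
    by (metis comm_scalar_prod)
  finally show "v \<bullet> ((?M * ?D + ?D\<^sup>T * ?M) *\<^sub>v u) = 0"
    using AF_energy_product_skew[OF assms u v] by simp
qed

lemma AF_grid_nodes:
  assumes "xmin < xmax" "n > 0"
  shows "\<forall>k<2 * n. AF_grid xmin xmax n $ k \<in> {xmin..xmax}"
    and "\<forall>j k. j \<le> k \<longrightarrow> k < 2 * n \<longrightarrow> AF_grid xmin xmax n $ j \<le> AF_grid xmin xmax n $ k"
proof -
  let ?h = "cell_size xmin xmax n / 2"
  have h: "?h > 0" and width: "real (2 * n) * ?h = xmax - xmin"
    using assms by (simp_all add: cell_size_def)
  have mono: "real j * ?h \<le> real k * ?h" if "j \<le> k" for j k
    using that h by (intro mult_right_mono) simp_all
  show "\<forall>k<2 * n. AF_grid xmin xmax n $ k \<in> {xmin..xmax}"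
  proof (intro allI impI)
    fix k assume "k < 2 * n"
    moreover from this have "0 \<le> real k * ?h" "real k * ?h \<le> xmax - xmin"
      using mono[of 0 k] mono[of k "2 * n"] unfolding width by simp_all
    ultimately show "AF_grid xmin xmax n $ k \<in> {xmin..xmax}"
      by (simp add: AF_grid_def)
  qed
  show "\<forall>j k. j \<le> k \<longrightarrow> k < 2 * n \<longrightarrow> AF_grid xmin xmax n $ j \<le> AF_grid xmin xmax n $ k"
    using mono by (simp add: AF_grid_def)
qed

theorem theorem3p1:
  fixes xmin xmax dx :: real and n :: nat and D M :: "real mat"
  assumes "xmin < xmax" and "n \<ge> 1"
  defines "dx \<equiv> cell_size xmin xmax n"
  defines "D \<equiv> AF_D dx n"
  defines "M \<equiv> AF_M dx n"
  shows
    "(\<forall>u\<in>carrier_vec (2 * n). \<forall>i.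
        cell_avg n (D *\<^sub>v u) i = (point_val n u i - point_val n u (i - 1)) / dx \<and>
        point_val n (D *\<^sub>v u) i =
          (point_val n u (i - 1) - 3 * cell_avg n u i + 3 * cell_avg n u (i + 1)
            - point_val n u (i + 1)) / dx) \<and>
     (\<forall>u\<in>carrier_vec (2 * n). \<forall>i.
        cell_avg n (M *\<^sub>v u) i = 3 * dx / 4 * cell_avg n u i \<and>
        point_val n (M *\<^sub>v u) i = dx / 4 * point_val n u i) \<and>
     (\<forall>T u. (\<forall>t\<in>T. u t \<in> carrier_vec (2 * n)) \<longrightarrow>
        (central_active_flux dx n T u \<longleftrightarrow> linear_ode (2 * n) D T u)) \<and>
     periodic_diagonal_norm_SBP xmin xmax (2 * n) (AF_grid xmin xmax n) D M \<and>
     scalar_prod (ones_vec (2 * n)) (M *\<^sub>v ones_vec (2 * n)) = xmax - xmin"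
proof -
  have dx: "dx > 0" and width: "real n * dx = xmax - xmin"
    using assms(1,2) by (simp_all add: dx_def cell_size_def)
  have n: "n > 0" using assms(2) by simp
  have mass: "ones_vec (2 * n) \<bullet> (M *\<^sub>v ones_vec (2 * n)) = xmax - xmin"
    unfolding M_def ones_AF_M_ones[OF n] by (rule width)
  have skew: "M * D + transpose_mat D * M = 0\<^sub>m (2 * n) (2 * n)"
    unfolding M_def D_def using dx by (intro AF_skew n) simp
  have "periodic_diagonal_norm_SBP xmin xmax (2 * n) (AF_grid xmin xmax n) D M"
    unfolding periodic_diagonal_norm_SBP_def periodic_SBP_def
    using AF_grid_nodes[OF assms(1) n] AF_D_ones[OF n, of dx] AF_M_positive_definite[OF n dx]
      AF_M_diagonal[of dx n] mass skew
    by (simp add: D_def M_def) (simp add: AF_grid_def)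
  then show ?thesis
    using mass central_active_flux_iff_linear_ode[OF n dx]
    by (simp add: D_def M_def AF_dofs[OF n])
qed

end
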